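(* Let $(\boldsymbol{X},\boldsymbol{T})$ and $(\boldsymbol{Y},\boldsymbol{R})$ be nonautonomous dynamical systems, $Z\subset X_0$ and $W\subset Y_0$. Then for all equicontinuous $\boldsymbol{f}\in\boldsymbol{C}(\boldsymbol{X},\mathbb{R})$ and equicontinuous $\boldsymbol{g}\in\boldsymbol{C}(\boldsymbol{Y},\mathbb{R})$, $$P^{\mathrm{L}}(\boldsymbol{T},\boldsymbol{f},Z)+P^{\mathrm{L}}(\boldsymbol{R},\boldsymbol{g},W)\le P^{\mathrm{L}}(\boldsymbol{T}\times\boldsymbol{R},\boldsymbol{f}\dotplus\boldsymbol{g},Z\times W)\le P^{\mathrm{L}}(\boldsymbol{T},\boldsymbol{f},Z)+P^{\mathrm{U}}(\boldsymbol{R},\boldsymbol{g},W),$$ where it is assumed that the sums of pressures appearing are well defined, i.e. not of the form $\infty-\infty$.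
   Context: A nonautonomous dynamical system (NDS) $(\boldsymbol{X},\boldsymbol{T})$ consists of a sequence $\boldsymbol{X}=\{X_k\}_{k=0}^\infty$ of compact metric spaces $(X_k,d_k)$ and a sequence $\boldsymbol{T}=\{T_k\}_{k=0}^\infty$ of continuous maps $T_k:X_k\to X_{k+1}$. Write $\boldsymbol{T}^0=\mathrm{id}_{X_0}$ and $\boldsymbol{T}^j=T_{j-1}\circ\cdots\circ T_0:X_0\to X_j$. For $n\ge 1$ the $n$-th Bowen metric on $X_0$ is $d_n^{\boldsymbol{T}}(x,y)=\max_{0\le j\le n-1}d_j(\boldsymbol{T}^jx,\boldsymbol{T}^jy)$. $\boldsymbol{C}(\boldsymbol{X},\mathbb{R})=\prod_{k\ge 0}C(X_k,\mathbb{R})$ is the set of sequences $\boldsymbol{f}=\{f_k\}_{k=0}^\infty$ of continuous functions $f_k:X_k\to\mathbb{R}$, and $S_n^{\boldsymbol{T}}\boldsymbol{f}=\sum_{j=0}^{n-1}f_j\circ\boldsymbol{T}^j$. $\boldsymbol{f}$ is equicontinuous if for every $\varepsilon>0$ there is $\delta>0$ such that for all $k\ge0$ and $x,y\in X_k$ with $d_k(x,y)<\delta$ we have $|f_k(x)-f_k(y)|<\varepsilon$. Products. $\boldsymbol{X}\times\boldsymbol{Y}=\{X_k\times Y_k\}_{k\ge0}$ with metrics $\max\{d_{X_k}(x_1,x_2),d_{Y_k}(y_1,y_2)\}$; $\boldsymbol{T}\times\boldsymbol{R}=\{T_k\times R_k\}_{k\ge0}$ with $(T_k\times R_k)(x,y)=(T_kx,R_ky)$;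 $\boldsymbol{f}\dotplus\boldsymbol{g}=\{f_k\dotplus g_k\}_{k\ge0}$ with $(f_k\dotplus g_k)(x,y)=f_k(x)+g_k(y)$. Lower and upper pressures. For $Z\subset X_0$, $n\ge1$, $\varepsilon>0$: $F\subset X_0$ is $(n,\varepsilon)$-spanning for $Z$ if for every $x\in Z$ there is $y\in F$ with $d_n^{\boldsymbol{T}}(x,y)\le\varepsilon$; $E\subset Z$ is $(n,\varepsilon)$-separated for $Z$ if $d_n^{\boldsymbol{T}}(x,y)>\varepsilon$ for all distinct $x,y\in E$. Let $Q_n(\boldsymbol{T},\boldsymbol{f},Z,\varepsilon)=\inf_F\sum_{x\in F}e^{S_n^{\boldsymbol{T}}\boldsymbol{f}(x)}$ over $(n,\varepsilon)$-spanning sets $F$ for $Z$ and $P_n(\boldsymbol{T},\boldsymbol{f},Z,\varepsilon)=\sup_E\sum_{x\in E}e^{S_n^{\boldsymbol{T}}\boldsymbol{f}(x)}$ over $(n,\varepsilon)$-separated sets $E$ for $Z$. Let $\underline{Q}(\boldsymbol{T},\boldsymbol{f},Z,\varepsilon)$, $\overline{Q}(\boldsymbol{T},\boldsymbol{f},Z,\varepsilon)$ be the $\liminf$, $\limsup$ as $n\to\infty$ of $\frac1n\log Q_n(\boldsymbol{T},\boldsymbol{f},Z,\varepsilon)$, and $\underline{P}(\boldsymbol{T},\boldsymbol{f},Z,\varepsilon)$, $\overline{P}(\boldsymbol{T},\boldsymbol{f},Z,\varepsilon)$ those of $\frac1n\log P_n(\boldsymbol{T},\boldsymbol{f},Z,\varepsilon)$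 ($\log 0=-\infty$). Then $\underline{Q},\overline{Q},\underline{P},\overline{P}(\boldsymbol{T},\boldsymbol{f},Z)\in\mathbb{R}\cup\{\pm\infty\}$ are the (monotone) limits of these as $\varepsilon\to0$. When $\underline{Q}(\boldsymbol{T},\boldsymbol{f},Z)=\underline{P}(\boldsymbol{T},\boldsymbol{f},Z)$ the common value is denoted $P^{\mathrm{L}}(\boldsymbol{T},\boldsymbol{f},Z)$; when $\overline{Q}(\boldsymbol{T},\boldsymbol{f},Z)=\overline{P}(\boldsymbol{T},\boldsymbol{f},Z)$ the common value is denoted $P^{\mathrm{U}}(\boldsymbol{T},\boldsymbol{f},Z)$. Both equalities hold whenever $\boldsymbol{f}$ is equicontinuous. *)

theory Defs
  imports "HOL-Analysis.Analysis"
begin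

section \<open>Nonautonomous dynamical systems\<close>

text \<open>
  The spaces of a system are metric spaces whose carriers are subsets of one common type;
  since every sequence of spaces embeds into its disjoint union, this is no restriction.
  Maps and functions are total on the type, and only their values on the carriers matter.
\<close>

definition nds :: "(nat \<Rightarrow> 'a metric) \<Rightarrow> (nat \<Rightarrow> 'a \<Rightarrow> 'a) \<Rightarrow> bool" where
  "nds X T \<longleftrightarrow>
     (\<forall>k. compact_space (mtopology_of (X k))) \<and>
     (\<forall>k. continuous_map (mtopology_of (X k)) (mtopology_of (X (Suc k))) (T k))"

primrec nds_iter :: "(nat \<Rightarrow> 'a \<Rightarrow> 'a) \<Rightarrow> nat \<Rightarrow> 'a \<Rightarrow> 'a" where
  "nds_iter T 0 = id"
| "nds_iter T (Suc j) = T j \<circ> nds_iter T j"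

text \<open>Only meaningful for \<open>n \<ge> 1\<close>; at \<open>n = 0\<close> the maximum is over the empty set. The pressures
  below depend on large \<open>n\<close> only.\<close>
definition bowen_dist ::
  "(nat \<Rightarrow> 'a metric) \<Rightarrow> (nat \<Rightarrow> 'a \<Rightarrow> 'a) \<Rightarrow> nat \<Rightarrow> 'a \<Rightarrow> 'a \<Rightarrow> real" where
  "bowen_dist X T n x y = (MAX j\<in>{..<n}. mdist (X j) (nds_iter T j x) (nds_iter T j y))"

definition cont_seq :: "(nat \<Rightarrow> 'a metric) \<Rightarrow> (nat \<Rightarrow> 'a \<Rightarrow> real) \<Rightarrow> bool" where
  "cont_seq X f \<longleftrightarrow> (\<forall>k. continuous_map (mtopology_of (X k)) euclideanreal (f k))"

definition equicont_seq :: "(nat \<Rightarrow> 'a metric) \<Rightarrow> (nat \<Rightarrow> 'a \<Rightarrow> real) \<Rightarrow> bool" where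
  "equicont_seq X f \<longleftrightarrow>
     (\<forall>\<epsilon>>0. \<exists>\<delta>>0. \<forall>k. \<forall>x\<in>mspace (X k). \<forall>y\<in>mspace (X k).
        mdist (X k) x y < \<delta> \<longrightarrow> \<bar>f k x - f k y\<bar> < \<epsilon>)"

definition birkhoff_sum ::
  "(nat \<Rightarrow> 'a \<Rightarrow> 'a) \<Rightarrow> (nat \<Rightarrow> 'a \<Rightarrow> real) \<Rightarrow> nat \<Rightarrow> 'a \<Rightarrow> real" where
  "birkhoff_sum T f n x = (\<Sum>j<n. f j (nds_iter T j x))"


section \<open>Products\<close>

text \<open>The library's \<open>prod_metric\<close> is the Euclidean product; here the maximum metric is needed.\<close>
definition max_prod_metric :: "'a metric \<Rightarrow> 'b metric \<Rightarrow> ('a \<times> 'b) metric" where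
  "max_prod_metric A B =
     metric (mspace A \<times> mspace B,
             \<lambda>p q. max (mdist A (fst p) (fst q)) (mdist B (snd p) (snd q)))"

lemma Metric_space_max_prod:
  "Metric_space (mspace A \<times> mspace B)
     (\<lambda>p q. max (mdist A (fst p) (fst q)) (mdist B (snd p) (snd q)))"
proof
  fix p q r
  show "0 \<le> max (mdist A (fst p) (fst q)) (mdist B (snd p) (snd q))"
    by (simp add: le_max_iff_disj)
  show "max (mdist A (fst p) (fst q)) (mdist B (snd p) (snd q)) =
        max (mdist A (fst q) (fst p)) (mdist B (snd q) (snd p))"
    by (simp add: mdist_commute)
  assume p: "p \<in> mspace A \<times> mspace B" and q: "q \<in> mspace A \<times> mspace B"
  show "max (mdist A (fst p) (fst q)) (mdist B (snd p) (snd q)) = 0 \<longleftrightarrow> p = q"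
  proof
    assume "max (mdist A (fst p) (fst q)) (mdist B (snd p) (snd q)) = 0"
    then have "mdist A (fst p) (fst q) \<le> 0" "mdist B (snd p) (snd q) \<le> 0"
      by linarith+
    then have "mdist A (fst p) (fst q) = 0" "mdist B (snd p) (snd q) = 0"
      by (simp_all add: order_antisym)
    then show "p = q"
      using p q by (auto simp: mem_Times_iff prod_eq_iff)
  next
    assume "p = q"
    then show "max (mdist A (fst p) (fst q)) (mdist B (snd p) (snd q)) = 0"
      using p mdist_zero[of "fst q" A "fst q"] mdist_zero[of "snd q" B "snd q"]
      by (simp add: mem_Times_iff del: mdist_zero)
  qed
  assume r: "r \<in> mspace A \<times> mspace B"
  have "mdist A (fst p) (fst r) \<le> mdist A (fst p) (fst q) + mdist A (fst q) (fst r)"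
       "mdist B (snd p) (snd r) \<le> mdist B (snd p) (snd q) + mdist B (snd q) (snd r)"
    using p q r by (auto simp: mem_Times_iff intro!: mdist_triangle)
  then show "max (mdist A (fst p) (fst r)) (mdist B (snd p) (snd r)) \<le>
      max (mdist A (fst p) (fst q)) (mdist B (snd p) (snd q)) +
      max (mdist A (fst q) (fst r)) (mdist B (snd q) (snd r))"
    by linarith
qed

lemma mspace_max_prod_metric [simp]: "mspace (max_prod_metric A B) = mspace A \<times> mspace B"
  and mdist_max_prod_metric [simp]:
    "mdist (max_prod_metric A B) p q = max (mdist A (fst p) (fst q)) (mdist B (snd p) (snd q))"
  by (simp_all add: max_prod_metric_def Metric_space.mspace_metric Metric_space.mdist_metric
      Metric_space_max_prod)

definition prod_spaces ::
  "(nat \<Rightarrow> 'a metric) \<Rightarrow> (nat \<Rightarrow> 'b metric) \<Rightarrow> nat \<Rightarrow> ('a \<times> 'b) metric" where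
  "prod_spaces X Y k = max_prod_metric (X k) (Y k)"

definition prod_maps ::
  "(nat \<Rightarrow> 'a \<Rightarrow> 'a) \<Rightarrow> (nat \<Rightarrow> 'b \<Rightarrow> 'b) \<Rightarrow> nat \<Rightarrow> 'a \<times> 'b \<Rightarrow> 'a \<times> 'b" where
  "prod_maps T R k = map_prod (T k) (R k)"

definition dot_plus ::
  "(nat \<Rightarrow> 'a \<Rightarrow> real) \<Rightarrow> (nat \<Rightarrow> 'b \<Rightarrow> real) \<Rightarrow> nat \<Rightarrow> 'a \<times> 'b \<Rightarrow> real" where
  "dot_plus f g k = (\<lambda>(x, y). f k x + g k y)"


section \<open>Pressures\<close>

definition spanning_set ::
  "(nat \<Rightarrow> 'a metric) \<Rightarrow> (nat \<Rightarrow> 'a \<Rightarrow> 'a) \<Rightarrow> 'a set \<Rightarrow> nat \<Rightarrow> real \<Rightarrow> 'a set \<Rightarrow> bool" where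
  "spanning_set X T Z n \<epsilon> F \<longleftrightarrow>
     F \<subseteq> mspace (X 0) \<and> (\<forall>x\<in>Z. \<exists>y\<in>F. bowen_dist X T n x y \<le> \<epsilon>)"

definition separated_set ::
  "(nat \<Rightarrow> 'a metric) \<Rightarrow> (nat \<Rightarrow> 'a \<Rightarrow> 'a) \<Rightarrow> 'a set \<Rightarrow> nat \<Rightarrow> real \<Rightarrow> 'a set \<Rightarrow> bool" where
  "separated_set X T Z n \<epsilon> E \<longleftrightarrow>
     E \<subseteq> Z \<and> (\<forall>x\<in>E. \<forall>y\<in>E. x \<noteq> y \<longrightarrow> bowen_dist X T n x y > \<epsilon>)"

text \<open>The sums are taken in \<^typ>\<open>ennreal\<close>, so that infinite spanning sets are allowed and have a
  sum that is possibly infinite.\<close>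
definition exp_sum ::
  "(nat \<Rightarrow> 'a \<Rightarrow> 'a) \<Rightarrow> (nat \<Rightarrow> 'a \<Rightarrow> real) \<Rightarrow> nat \<Rightarrow> 'a set \<Rightarrow> ennreal" where
  "exp_sum T f n A = (\<Sum>\<^sub>\<infinity>x\<in>A. ennreal (exp (birkhoff_sum T f n x)))"

definition Q_sum ::
  "(nat \<Rightarrow> 'a metric) \<Rightarrow> (nat \<Rightarrow> 'a \<Rightarrow> 'a) \<Rightarrow> (nat \<Rightarrow> 'a \<Rightarrow> real) \<Rightarrow> 'a set \<Rightarrow> nat \<Rightarrow> real \<Rightarrow> ennreal" where
  "Q_sum X T f Z n \<epsilon> = (INF F\<in>{F. spanning_set X T Z n \<epsilon> F}. exp_sum T f n F)"

definition P_sum ::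
  "(nat \<Rightarrow> 'a metric) \<Rightarrow> (nat \<Rightarrow> 'a \<Rightarrow> 'a) \<Rightarrow> (nat \<Rightarrow> 'a \<Rightarrow> real) \<Rightarrow> 'a set \<Rightarrow> nat \<Rightarrow> real \<Rightarrow> ennreal" where
  "P_sum X T f Z n \<epsilon> = (SUP E\<in>{E. separated_set X T Z n \<epsilon> E}. exp_sum T f n E)"

definition ln_ennreal :: "ennreal \<Rightarrow> ereal" where
  "ln_ennreal a = (if a = 0 then -\<infinity> else if a = \<infinity> then \<infinity> else ereal (ln (enn2real a)))"

definition growth_rate :: "(nat \<Rightarrow> ennreal) \<Rightarrow> nat \<Rightarrow> ereal" where
  "growth_rate a n = ereal (1 / real n) * ln_ennreal (a n)"

definition lower_Q ::
  "(nat \<Rightarrow> 'a metric) \<Rightarrow> (nat \<Rightarrow> 'a \<Rightarrow> 'a) \<Rightarrow> (nat \<Rightarrow> 'a \<Rightarrow> real) \<Rightarrow> 'a set \<Rightarrow> ereal" where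
  "lower_Q X T f Z = Lim (at_right 0) (\<lambda>\<epsilon>. liminf (growth_rate (\<lambda>n. Q_sum X T f Z n \<epsilon>)))"

definition upper_Q ::
  "(nat \<Rightarrow> 'a metric) \<Rightarrow> (nat \<Rightarrow> 'a \<Rightarrow> 'a) \<Rightarrow> (nat \<Rightarrow> 'a \<Rightarrow> real) \<Rightarrow> 'a set \<Rightarrow> ereal" where
  "upper_Q X T f Z = Lim (at_right 0) (\<lambda>\<epsilon>. limsup (growth_rate (\<lambda>n. Q_sum X T f Z n \<epsilon>)))"

definition lower_P ::
  "(nat \<Rightarrow> 'a metric) \<Rightarrow> (nat \<Rightarrow> 'a \<Rightarrow> 'a) \<Rightarrow> (nat \<Rightarrow> 'a \<Rightarrow> real) \<Rightarrow> 'a set \<Rightarrow> ereal" where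
  "lower_P X T f Z = Lim (at_right 0) (\<lambda>\<epsilon>. liminf (growth_rate (\<lambda>n. P_sum X T f Z n \<epsilon>)))"

definition upper_P ::
  "(nat \<Rightarrow> 'a metric) \<Rightarrow> (nat \<Rightarrow> 'a \<Rightarrow> 'a) \<Rightarrow> (nat \<Rightarrow> 'a \<Rightarrow> real) \<Rightarrow> 'a set \<Rightarrow> ereal" where
  "upper_P X T f Z = Lim (at_right 0) (\<lambda>\<epsilon>. limsup (growth_rate (\<lambda>n. P_sum X T f Z n \<epsilon>)))"

text \<open>The common values: unspecified when the spanning and the separated pressures differ.\<close>

definition pressure_L ::
  "(nat \<Rightarrow> 'a metric) \<Rightarrow> (nat \<Rightarrow> 'a \<Rightarrow> 'a) \<Rightarrow> (nat \<Rightarrow> 'a \<Rightarrow> real) \<Rightarrow> 'a set \<Rightarrow> ereal" where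
  "pressure_L X T f Z = (THE p. lower_Q X T f Z = p \<and> lower_P X T f Z = p)"

definition pressure_U ::
  "(nat \<Rightarrow> 'a metric) \<Rightarrow> (nat \<Rightarrow> 'a \<Rightarrow> 'a) \<Rightarrow> (nat \<Rightarrow> 'a \<Rightarrow> real) \<Rightarrow> 'a set \<Rightarrow> ereal" where
  "pressure_U X T f Z = (THE p. upper_Q X T f Z = p \<and> upper_P X T f Z = p)"

text \<open>Addition on \<^typ>\<open>ereal\<close> is total (\<open>\<infinity> + -\<infinity> = \<infinity>\<close>), so the exclusion of
  \<open>\<infinity> - \<infinity>\<close> has to be stated.\<close>
definition sum_defined :: "ereal \<Rightarrow> ereal \<Rightarrow> bool" where
  "sum_defined a b \<longleftrightarrow> \<not> (a = \<infinity> \<and> b = -\<infinity>) \<and> \<not> (a = -\<infinity> \<and> b = \<infinity>)"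

end

theory Submission
  imports Defs
begin

text \<open>
  Since \<open>exp (S\<^sub>n (f + g))\<close> factors over a product, products of spanning sets give
  \<open>Q\<^sub>n(Z \<times> W) \<le> Q\<^sub>n(Z) Q\<^sub>n(W)\<close> and products of separated sets give
  \<open>P\<^sub>n(Z) P\<^sub>n(W) \<le> P\<^sub>n(Z \<times> W)\<close>. The bounds follow from
  \<open>liminf (a + b) \<le> liminf a + limsup b\<close> and \<open>liminf a + liminf b \<le> liminf (a + b)\<close> by letting
  \<open>\<epsilon>\<close> tend to \<open>0\<close>, because spanning and separated pressures agree: a maximal separated set is spanning,
  and conversely a point of a separated set is charged to a nearby point of a spanning set, at a
  cost controlled by equicontinuity. Maximal separated sets, possibly infinite, come from Zorn's lemma.
\<close>

section \<open>Orbits, Birkhoff sums and Bowen metrics, also on products\<close>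

text \<open>Invariance of the carriers along orbits, separated from the topology so that it passes
  to products coordinate by coordinate.\<close>

definition carrier_maps :: "(nat \<Rightarrow> 'a metric) \<Rightarrow> (nat \<Rightarrow> 'a \<Rightarrow> 'a) \<Rightarrow> bool" where
  "carrier_maps X T \<longleftrightarrow> (\<forall>j. \<forall>x\<in>mspace (X j). T j x \<in> mspace (X (Suc j)))"

lemma nds_carrier_maps: "nds X T \<Longrightarrow> carrier_maps X T"
  unfolding nds_def carrier_maps_def continuous_map_def by (auto simp: Pi_iff)

lemma carrier_maps_prod:
  "carrier_maps X T \<Longrightarrow> carrier_maps Y R \<Longrightarrow> carrier_maps (prod_spaces X Y) (prod_maps T R)"
  by (auto simp: carrier_maps_def prod_spaces_def prod_maps_def)

lemma nds_iter_in_mspace: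
  assumes "carrier_maps X T" "x \<in> mspace (X 0)"
  shows "nds_iter T j x \<in> mspace (X j)"
  using assms by (induction j) (auto simp: carrier_maps_def)

lemma nds_iter_prod [simp]:
  "nds_iter (prod_maps T R) j p = (nds_iter T j (fst p), nds_iter R j (snd p))"
  by (induction j) (auto simp: prod_maps_def)

lemma birkhoff_sum_prod [simp]:
  "birkhoff_sum (prod_maps T R) (dot_plus f g) n p =
     birkhoff_sum T f n (fst p) + birkhoff_sum R g n (snd p)"
  by (simp add: birkhoff_sum_def dot_plus_def sum.distrib)

lemma equicont_seqE:
  assumes "equicont_seq X f" "e > 0"
  obtains d where "d > 0" "\<And>k x y. x \<in> mspace (X k) \<Longrightarrow> y \<in> mspace (X k) \<Longrightarrow>
      mdist (X k) x y < d \<Longrightarrow> \<bar>f k x - f k y\<bar> < e"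
proof -
  have "\<exists>d>0. \<forall>k. \<forall>x\<in>mspace (X k). \<forall>y\<in>mspace (X k). mdist (X k) x y < d \<longrightarrow> \<bar>f k x - f k y\<bar> < e"
    using assms unfolding equicont_seq_def by simp
  then show thesis
    by (elim exE conjE, intro that) auto
qed

lemma equicont_seq_dot_plus:
  assumes "equicont_seq X f" "equicont_seq Y g"
  shows "equicont_seq (prod_spaces X Y) (dot_plus f g)"
  unfolding equicont_seq_def
proof (intro allI impI)
  fix e :: real assume "e > 0"
  then have e2: "e / 2 > 0" by simp
  obtain a where a: "a > 0" "\<And>k x y. x \<in> mspace (X k) \<Longrightarrow> y \<in> mspace (X k) \<Longrightarrow>
      mdist (X k) x y < a \<Longrightarrow> \<bar>f k x - f k y\<bar> < e / 2"
    by (rule equicont_seqE[OF assms(1) e2]) (rule that)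
  obtain b where b: "b > 0" "\<And>k x y. x \<in> mspace (Y k) \<Longrightarrow> y \<in> mspace (Y k) \<Longrightarrow>
      mdist (Y k) x y < b \<Longrightarrow> \<bar>g k x - g k y\<bar> < e / 2"
    by (rule equicont_seqE[OF assms(2) e2]) (rule that)
  have "\<bar>dot_plus f g k p - dot_plus f g k q\<bar> < e"
    if "p \<in> mspace (prod_spaces X Y k)" "q \<in> mspace (prod_spaces X Y k)"
      "mdist (prod_spaces X Y k) p q < min a b" for k p q
  proof -
    have "\<bar>f k (fst p) - f k (fst q)\<bar> < e / 2" "\<bar>g k (snd p) - g k (snd q)\<bar> < e / 2"
      by (rule a(2) b(2); use that in \<open>simp add: prod_spaces_def mem_Times_iff\<close>)+
    then show ?thesis unfolding dot_plus_def split_def by linarith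
  qed
  then show "\<exists>\<delta>>0. \<forall>k. \<forall>x\<in>mspace (prod_spaces X Y k). \<forall>y\<in>mspace (prod_spaces X Y k).
      mdist (prod_spaces X Y k) x y < \<delta> \<longrightarrow> \<bar>dot_plus f g k x - dot_plus f g k y\<bar> < e"
    using a(1) b(1) by (intro exI[of _ "min a b"]) simp
qed

text \<open>The working form of the Bowen metric: estimates are made one time \<open>j\<close> at a
  time. For \<open>n > 0\<close> the maximum is over a nonempty set.\<close>

lemma bowen_dist_le_iff:
  "n > 0 \<Longrightarrow> bowen_dist X T n x y \<le> e \<longleftrightarrow>
     (\<forall>j<n. mdist (X j) (nds_iter T j x) (nds_iter T j y) \<le> e)"
  unfolding bowen_dist_def by (subst Max_le_iff) auto

lemma bowen_dist_commute: "bowen_dist X T n x y = bowen_dist X T n y x"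
  by (simp add: bowen_dist_def mdist_commute)

lemma bowen_dist_triangle_le:
  assumes "carrier_maps X T" "n > 0"
    and "x \<in> mspace (X 0)" "y \<in> mspace (X 0)" "z \<in> mspace (X 0)"
    and "bowen_dist X T n x y \<le> a" "bowen_dist X T n y z \<le> b"
  shows "bowen_dist X T n x z \<le> a + b"
  unfolding bowen_dist_le_iff[OF assms(2)]
proof (intro allI impI)
  fix j assume "j < n"
  then have "mdist (X j) (nds_iter T j x) (nds_iter T j y) \<le> a"
      "mdist (X j) (nds_iter T j y) (nds_iter T j z) \<le> b"
    using assms(6,7) by (simp_all add: bowen_dist_le_iff[OF assms(2)])
  moreover have "mdist (X j) (nds_iter T j x) (nds_iter T j z) \<le>
      mdist (X j) (nds_iter T j x) (nds_iter T j y) + mdist (X j) (nds_iter T j y) (nds_iter T j z)"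
    by (intro mdist_triangle nds_iter_in_mspace assms)
  ultimately show "mdist (X j) (nds_iter T j x) (nds_iter T j z) \<le> a + b"
    by linarith
qed

text \<open>For the maximum metric a Bowen ball of the product is the product of Bowen balls of the
  same radius, so products of spanning or separated sets need no change of scale.\<close>

lemma bowen_dist_prod_le_iff:
  "n > 0 \<Longrightarrow> bowen_dist (prod_spaces X Y) (prod_maps T R) n p q \<le> e \<longleftrightarrow>
     bowen_dist X T n (fst p) (fst q) \<le> e \<and> bowen_dist Y R n (snd p) (snd q) \<le> e"
  by (auto simp: bowen_dist_le_iff prod_spaces_def)

text \<open>Both orbits stay closer than \<open>d\<close> up to time \<open>n - 1\<close>, so each
  of the \<open>n\<close> summands changes by less than \<open>e\<close>. After division by
  \<open>n\<close> only \<open>e\<close> remains.\<close>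

lemma birkhoff_sum_le_of_bowen_dist:
  assumes "carrier_maps X T" "n > 0" "x \<in> mspace (X 0)" "y \<in> mspace (X 0)"
    and "bowen_dist X T n x y < d"
    and f: "\<And>k x y. x \<in> mspace (X k) \<Longrightarrow> y \<in> mspace (X k) \<Longrightarrow> mdist (X k) x y < d \<Longrightarrow>
       \<bar>f k x - f k y\<bar> < e"
  shows "birkhoff_sum T f n x \<le> real n * e + birkhoff_sum T f n y"
proof -
  have "f j (nds_iter T j x) \<le> e + f j (nds_iter T j y)" if "j < n" for j
  proof -
    have "mdist (X j) (nds_iter T j x) (nds_iter T j y) \<le> bowen_dist X T n x y"
      using bowen_dist_le_iff[OF \<open>n > 0\<close>, of X T x y "bowen_dist X T n x y"] that by simp
    then show ?thesis
      using f[of "nds_iter T j x" j "nds_iter T j y"] assms(5)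
        nds_iter_in_mspace[OF assms(1,3), of j] nds_iter_in_mspace[OF assms(1,4), of j]
      by linarith
  qed
  then have "birkhoff_sum T f n x \<le> (\<Sum>j<n. e + f j (nds_iter T j y))"
    unfolding birkhoff_sum_def by (intro sum_mono) auto
  also have "\<dots> = real n * e + birkhoff_sum T f n y"
    by (simp add: birkhoff_sum_def sum.distrib)
  finally show ?thesis .
qed

section \<open>Exponential sums over possibly infinite sets\<close>

text \<open>In \<open>ennreal\<close> an infinite sum is the supremum of its finite partial sums,
  which reduces the estimates below to finite sets.\<close>

lemma exp_sum_SUP:
  "exp_sum T f n A =
     (SUP F\<in>{F. finite F \<and> F \<subseteq> A}. \<Sum>x\<in>F. ennreal (exp (birkhoff_sum T f n x)))"
  unfolding exp_sum_def by (rule nonneg_infsum_complete) simp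

lemma exp_sum_prod:
  "exp_sum (prod_maps T R) (dot_plus f g) n (A \<times> B) = exp_sum T f n A * exp_sum R g n B"
proof -
  let ?u = "\<lambda>x. ennreal (exp (birkhoff_sum T f n x))"
  let ?v = "\<lambda>y. ennreal (exp (birkhoff_sum R g n y))"
  let ?w = "\<lambda>p. ennreal (exp (birkhoff_sum (prod_maps T R) (dot_plus f g) n p))"
  have rect: "(\<Sum>x\<in>F. ?u x) * (\<Sum>y\<in>G. ?v y) = (\<Sum>p\<in>F \<times> G. ?w p)" for F G
    by (simp add: sum_product sum.cartesian_product exp_add ennreal_mult split_def del: sum_ennreal)
  show ?thesis
  proof (rule antisym)
    show "exp_sum (prod_maps T R) (dot_plus f g) n (A \<times> B) \<le> exp_sum T f n A * exp_sum R g n B"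
      unfolding exp_sum_SUP[of _ _ _ "A \<times> B"]
    proof (rule SUP_least)
      fix H assume "H \<in> {F. finite F \<and> F \<subseteq> A \<times> B}"
      then have H: "finite H" "fst ` H \<subseteq> A" "snd ` H \<subseteq> B" by auto
      \<comment> \<open>A finite subset of \<open>A \<times> B\<close> need not be a rectangle, but
        it lies in the rectangle of its two projections, and all terms are nonnegative.\<close>
      have "sum ?w H \<le> sum ?w (fst ` H \<times> snd ` H)"
        using H(1) by (intro sum_mono2) (auto intro: rev_image_eqI)
      also have "\<dots> = sum ?u (fst ` H) * sum ?v (snd ` H)"
        by (rule rect[symmetric])
      also have "\<dots> \<le> exp_sum T f n A * exp_sum R g n B"
        unfolding exp_sum_SUP using H by (intro mult_mono SUP_upper) auto
      finally show "sum ?w H \<le> exp_sum T f n A * exp_sum R g n B" .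
    qed
    show "exp_sum T f n A * exp_sum R g n B \<le> exp_sum (prod_maps T R) (dot_plus f g) n (A \<times> B)"
      \<comment> \<open>Multiplication commutes with suprema in \<open>ennreal\<close>, even at 0
        and \<open>top\<close>, so finite rectangles suffice.\<close>
      unfolding exp_sum_SUP[of T] exp_sum_SUP[of R] SUP_mult_left_ennreal SUP_mult_right_ennreal
    proof (intro SUP_least)
      fix F G assume "F \<in> {F. finite F \<and> F \<subseteq> A}" "G \<in> {F. finite F \<and> F \<subseteq> B}"
      then show "sum ?u F * sum ?v G \<le> exp_sum (prod_maps T R) (dot_plus f g) n (A \<times> B)"
        unfolding exp_sum_SUP rect by (intro SUP_upper) auto
    qed
  qed
qed

text \<open>A charging argument: each \<open>x\<close> is paid for by \<open>h x\<close> up to the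
  factor \<open>exp c\<close>, and injectivity keeps any point of \<open>B\<close> from being
  charged twice.\<close>

lemma exp_sum_le_inj:
  assumes "inj_on h A" "h ` A \<subseteq> B" "c \<ge> 0"
    and "\<And>x. x \<in> A \<Longrightarrow> birkhoff_sum T f n x \<le> c + birkhoff_sum T f n (h x)"
  shows "exp_sum T f n A \<le> ennreal (exp c) * exp_sum T f n B"
  unfolding exp_sum_SUP[of _ _ _ A]
proof (rule SUP_least)
  fix F assume "F \<in> {F. finite F \<and> F \<subseteq> A}"
  then have F: "finite F" "F \<subseteq> A" by auto
  have "(\<Sum>x\<in>F. ennreal (exp (birkhoff_sum T f n x)))
      \<le> (\<Sum>x\<in>F. ennreal (exp c) * ennreal (exp (birkhoff_sum T f n (h x))))"
    using F assms(4) by (intro sum_mono) (auto simp flip: ennreal_mult exp_add intro!: ennreal_leI)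
  also have "\<dots> = ennreal (exp c) * (\<Sum>y\<in>h ` F. ennreal (exp (birkhoff_sum T f n y)))"
    using F assms(1) by (subst sum.reindex) (auto simp: sum_distrib_left simp del: sum_ennreal intro: inj_on_subset)
  also have "\<dots> \<le> ennreal (exp c) * exp_sum T f n B"
    unfolding exp_sum_SUP using F assms(2) by (intro mult_left_mono SUP_upper) auto
  finally show "(\<Sum>x\<in>F. ennreal (exp (birkhoff_sum T f n x))) \<le> ennreal (exp c) * exp_sum T f n B" .
qed

section \<open>Infima of products of extended nonnegative reals\<close>

text \<open>A monotone map continuous at the infimum commutes with it. \<open>c = top\<close> is
  excluded since multiplication by \<open>top\<close> jumps at 0, the empty index set since its
  infimum is \<open>top\<close> and \<open>0 * top = 0\<close>.\<close>

lemma mult_INF_ennreal: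
  fixes c :: ennreal
  assumes "c < top" "I \<noteq> {}"
  shows "c * (INF i\<in>I. u i) = (INF i\<in>I. c * u i)"
proof -
  have "continuous_on UNIV (\<lambda>x. c * x)"
    using assms(1) by (intro ennreal_continuous_on_cmult continuous_on_id)
  then have "continuous (at_right (Inf (u ` I))) (\<lambda>x. c * x)"
    by (simp add: continuous_on_eq_continuous_within continuous_at_imp_continuous_at_within)
  then have "c * Inf (u ` I) = (INF s\<in>u ` I. c * s)"
    using assms(2) by (intro continuous_at_Inf_mono) (auto simp: mono_def mult_left_mono)
  then show ?thesis by (simp add: image_image)
qed

text \<open>One infimum is taken at a time: first over \<open>J\<close> against a fixed finite
  \<open>u i\<close>, then over \<open>I\<close>. Finiteness of both infima rules out a product of 0
  and \<open>top\<close>.\<close>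

lemma le_INF_mult_INF_ennreal:
  fixes u :: "'i \<Rightarrow> ennreal" and v :: "'j \<Rightarrow> ennreal"
  assumes "\<And>i j. i \<in> I \<Longrightarrow> j \<in> J \<Longrightarrow> q \<le> u i * v j"
    and fin: "(INF i\<in>I. u i) < top" "(INF j\<in>J. v j) < top"
  shows "q \<le> (INF i\<in>I. u i) * (INF j\<in>J. v j)"
proof -
  let ?b = "INF j\<in>J. v j"
  have ne: "I \<noteq> {}" "J \<noteq> {}" using fin by auto
  have le: "q \<le> u i * ?b" if "i \<in> I" "u i < top" for i
    using assms(1) that ne by (auto simp: mult_INF_ennreal intro!: INF_greatest)
  obtain i0 where i0: "i0 \<in> I" "u i0 < top"
    using fin(1) by (auto simp: INF_less_iff)
  have "q \<le> ?b * u i" if "i \<in> I" for i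
  proof (cases "u i < top")
    case True
    then show ?thesis using le[OF that] by (simp add: mult.commute)
  next
    \<comment> \<open>Here \<open>u i = top\<close>. The right side is \<open>top\<close> unless
      \<open>?b = 0\<close>, and in that case the bound at the finite \<open>u i0\<close> gives
      \<open>q = 0\<close>.\<close>
    case False
    then show ?thesis
      using le[OF i0] by (cases "?b = 0") (auto simp: ennreal_mult_top less_top[symmetric])
  qed
  then have "q \<le> ?b * (INF i\<in>I. u i)"
    unfolding mult_INF_ennreal[OF fin(2) ne(1)] by (rule INF_greatest)
  then show ?thesis by (simp add: mult.commute)
qed

section \<open>Spanning and separated sums at a fixed scale\<close>

lemma spanning_set_mono: "spanning_set X T Z n d F \<Longrightarrow> d \<le> e \<Longrightarrow> spanning_set X T Z n e F"
  unfolding spanning_set_def by (meson order_trans)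

lemma separated_set_antimono:
  "separated_set X T Z n e E \<Longrightarrow> d \<le> e \<Longrightarrow> separated_set X T Z n d E"
  unfolding separated_set_def by (meson le_less_trans)

lemma Q_sum_antimono: "d \<le> e \<Longrightarrow> Q_sum X T f Z n e \<le> Q_sum X T f Z n d"
  unfolding Q_sum_def by (rule INF_superset_mono) (auto elim: spanning_set_mono)

lemma P_sum_antimono: "d \<le> e \<Longrightarrow> P_sum X T f Z n e \<le> P_sum X T f Z n d"
  unfolding P_sum_def by (rule SUP_subset_mono) (auto elim: separated_set_antimono)

text \<open>Upper bounds of chains for Zorn's lemma: two points of the union already lie in one
  member of the chain, where they are separated.\<close>

lemma separated_set_Union_chain:
  assumes "subset.chain {E. separated_set X T Z n e E} C"
  shows "separated_set X T Z n e (\<Union>C)"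
  unfolding separated_set_def
proof (intro conjI ballI impI)
  have sep: "separated_set X T Z n e D" if "D \<in> C" for D
    using assms that by (auto simp: subset.chain_def)
  then show "\<Union>C \<subseteq> Z"
    by (auto simp: separated_set_def)
  fix x y assume "x \<in> \<Union>C" "y \<in> \<Union>C" "x \<noteq> y"
  then obtain A B where AB: "A \<in> C" "B \<in> C" "x \<in> A" "y \<in> B" by auto
  have "A \<subseteq> B \<or> B \<subseteq> A"
    using assms AB(1,2) by (auto simp: subset_chain_def)
  then show "e < bowen_dist X T n x y"
  proof
    assume "A \<subseteq> B"
    with AB sep[of B] \<open>x \<noteq> y\<close> show ?thesis by (auto simp: separated_set_def)
  next
    assume "B \<subseteq> A"
    with AB sep[of A] \<open>x \<noteq> y\<close> show ?thesis by (auto simp: separated_set_def)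
  qed
qed

lemma Q_sum_le_P_sum:
  assumes "carrier_maps X T" "Z \<subseteq> mspace (X 0)" "n > 0" "e \<ge> 0"
  shows "Q_sum X T f Z n e \<le> P_sum X T f Z n e"
proof -
  have "\<exists>M\<in>{E. separated_set X T Z n e E}. \<forall>E\<in>{E. separated_set X T Z n e E}. M \<subseteq> E \<longrightarrow> E = M"
    by (rule subset_Zorn') (rule CollectI, rule separated_set_Union_chain)
  then obtain M where M: "separated_set X T Z n e M"
    and max: "\<And>E. separated_set X T Z n e E \<Longrightarrow> M \<subseteq> E \<Longrightarrow> E = M"
    by auto
  have "\<exists>y\<in>M. bowen_dist X T n x y \<le> e" if x: "x \<in> Z" for x
  proof (cases "x \<in> M")
    case True
    have "mdist (X j) (nds_iter T j x) (nds_iter T j x) = 0" for j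
      using nds_iter_in_mspace[of X T x j] assms(1,2) x by (subst mdist_zero) auto
    then have "bowen_dist X T n x x \<le> e"
      unfolding bowen_dist_le_iff[OF assms(3)] using assms(4) by simp
    with True show ?thesis by (rule rev_bexI)
  next
    case False
    show ?thesis
    proof (rule ccontr)
      \<comment> \<open>Otherwise \<open>x\<close> could be added to \<open>M\<close>, against
        maximality. Both orders of the arguments occur because separation is asked of ordered
        pairs.\<close>
      assume "\<not> ?thesis"
      then have far: "e < bowen_dist X T n x y" "e < bowen_dist X T n y x" if "y \<in> M" for y
        using that by (auto simp: not_le bowen_dist_commute[of X T n y x])
      have "separated_set X T Z n e (insert x M)"
        using M x far by (simp add: separated_set_def)
      from max[OF this] False show False by auto
    qed
  qed
  then have "spanning_set X T Z n e M"
    using M assms(2) by (auto simp: spanning_set_def separated_set_def)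
  then have "Q_sum X T f Z n e \<le> exp_sum T f n M"
    unfolding Q_sum_def by (intro INF_lower) simp
  also have "\<dots> \<le> P_sum X T f Z n e"
    unfolding P_sum_def using M by (intro SUP_upper) simp
  finally show ?thesis .
qed

text \<open>Two points of a separated set at scale \<open>e\<close> cannot be within \<open>e / 2\<close> of the same point
  of a spanning set.\<close>
lemma P_sum_le_Q_sum:
  assumes "carrier_maps X T" "Z \<subseteq> mspace (X 0)" "n > 0" "0 < e" "e \<le> d" "c \<ge> 0"
    and f: "\<And>k x y. x \<in> mspace (X k) \<Longrightarrow> y \<in> mspace (X k) \<Longrightarrow> mdist (X k) x y < d \<Longrightarrow>
       \<bar>f k x - f k y\<bar> < c"
  shows "P_sum X T f Z n e \<le> ennreal (exp (real n * c)) * Q_sum X T f Z n (e / 2)"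
proof -
  \<comment> \<open>An arbitrary separated set is compared with an arbitrary spanning set; supremum
    and infimum are taken only at the end.\<close>
  have le: "exp_sum T f n E \<le> ennreal (exp (real n * c)) * exp_sum T f n F"
    if E: "separated_set X T Z n e E" and F: "spanning_set X T Z n (e / 2) F" for E F
  proof -
    have "\<forall>x\<in>E. \<exists>y\<in>F. bowen_dist X T n x y \<le> e / 2"
      using E F by (auto simp: separated_set_def spanning_set_def)
    then obtain h where h: "\<And>x. x \<in> E \<Longrightarrow> h x \<in> F \<and> bowen_dist X T n x (h x) \<le> e / 2"
      by metis
    have sub: "E \<subseteq> mspace (X 0)" "F \<subseteq> mspace (X 0)"
      using E F assms(2) by (auto simp: separated_set_def spanning_set_def)
    have inj: "inj_on h E"
    proof (rule inj_onI, rule ccontr)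
      fix x y assume xy: "x \<in> E" "y \<in> E" "h x = h y" "x \<noteq> y"
      have "bowen_dist X T n x y \<le> e / 2 + e / 2"
        using xy sub h[of x] h[of y]
        by (intro bowen_dist_triangle_le[OF assms(1,3), of x "h x" y])
           (auto simp: bowen_dist_commute[of X T n _ y])
      then show False
        using E xy by (auto simp: separated_set_def not_le[symmetric])
    qed
    show ?thesis
    proof (rule exp_sum_le_inj[OF inj])
      show "h ` E \<subseteq> F" using h by auto
      show "real n * c \<ge> 0" using assms(6) by simp
      fix x assume "x \<in> E"
      then show "birkhoff_sum T f n x \<le> real n * c + birkhoff_sum T f n (h x)"
        \<comment> \<open>The distance is at most \<open>e / 2 < d\<close>, because
          \<open>0 < e \<le> d\<close>, so equicontinuity applies.\<close>
        using h[of x] sub assms(4,5)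
        by (intro birkhoff_sum_le_of_bowen_dist[OF assms(1,3) _ _ _ f]) auto
    qed
  qed
  show ?thesis
  proof (cases "{F. spanning_set X T Z n (e / 2) F} = {}")
    \<comment> \<open>Without spanning sets the infimum is \<open>top\<close>, and the positive
      factor keeps it \<open>top\<close>.\<close>
    case True
    then show ?thesis by (simp add: Q_sum_def ennreal_mult_top)
  next
    case False
    have "(INF F\<in>{F. spanning_set X T Z n (e / 2) F}. ennreal (exp (real n * c)) * exp_sum T f n F)
        = ennreal (exp (real n * c)) * Q_sum X T f Z n (e / 2)"
      unfolding Q_sum_def using False
      by (simp add: mult_INF_ennreal)
    moreover have "P_sum X T f Z n e \<le>
        (INF F\<in>{F. spanning_set X T Z n (e / 2) F}. ennreal (exp (real n * c)) * exp_sum T f n F)"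
      unfolding P_sum_def using le by (intro SUP_least INF_greatest) auto
    ultimately show ?thesis by simp
  qed
qed

section \<open>Logarithms and growth rates\<close>

lemma ln_ennreal_mono: "a \<le> b \<Longrightarrow> ln_ennreal a \<le> ln_ennreal b"
  by (cases a; cases b) (auto simp: ln_ennreal_def ennreal_le_iff2 top_unique split: if_splits)

text \<open>Zero factors are excluded because \<open>0 * top = 0\<close> has logarithm
  \<open>-\<infinity>\<close>, whereas \<open>-\<infinity> + \<infinity> = \<infinity>\<close> in
  \<open>ereal\<close>.\<close>

lemma ln_ennreal_mult:
  assumes "a \<noteq> 0" "b \<noteq> 0"
  shows "ln_ennreal (a * b) = ln_ennreal a + ln_ennreal b"
  using assms
  by (cases a; cases b)
     (auto simp: ln_ennreal_def ennreal_mult_top ennreal_top_mult ln_mult simp flip: ennreal_mult)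

text \<open>A zero factor makes the left side \<open>-\<infinity>\<close>, so subadditivity survives
  where additivity may fail.\<close>

lemma ln_ennreal_mult_le: "ln_ennreal (a * b) \<le> ln_ennreal a + ln_ennreal b"
proof (cases "a = 0 \<or> b = 0")
  case True
  then show ?thesis by (auto simp: ln_ennreal_def)
next
  case False
  then show ?thesis by (simp add: ln_ennreal_mult)
qed

lemma ln_ennreal_exp_mult: "ln_ennreal (ennreal (exp c) * a) = ereal c + ln_ennreal a"
proof (cases "a = 0")
  case True
  then show ?thesis by (simp add: ln_ennreal_def)
next
  case False
  then have "ln_ennreal (ennreal (exp c) * a) = ln_ennreal (ennreal (exp c)) + ln_ennreal a"
    by (intro ln_ennreal_mult) (auto simp: ennreal_eq_0_iff not_le)
  also have "ln_ennreal (ennreal (exp c)) = ereal c"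
    by (auto simp: ln_ennreal_def ennreal_eq_0_iff not_le)
  finally show ?thesis .
qed

lemma ereal_pos_mult_add:
  assumes "c > 0"
  shows "ereal c * (x + y) = ereal c * x + ereal c * y"
  using assms by (cases x; cases y) (auto simp: algebra_simps)

lemma growth_rate_mono: "a n \<le> b n \<Longrightarrow> growth_rate a n \<le> growth_rate b n"
  unfolding growth_rate_def by (intro ereal_mult_left_mono ln_ennreal_mono) auto

lemma growth_rate_exp_mult:
  "n > 0 \<Longrightarrow>
    growth_rate (\<lambda>n. ennreal (exp (real n * c)) * a n) n = ereal c + growth_rate a n"
  by (simp add: growth_rate_def ln_ennreal_exp_mult ereal_pos_mult_add)

text \<open>Lower and upper limits see only large \<open>n\<close>, so comparisons at positive
  \<open>n\<close> are enough.\<close>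

lemma eventually_growth_rate_mono:
  assumes "\<And>n. n > 0 \<Longrightarrow> a n \<le> b n"
  shows "eventually (\<lambda>n. growth_rate a n \<le> growth_rate b n) sequentially"
  using eventually_gt_at_top[of 0] by eventually_elim (intro growth_rate_mono assms)

section \<open>Products of spanning and of separated sets\<close>

lemma spanning_set_prod:
  assumes "n > 0" "spanning_set X T Z n e F" "spanning_set Y R W n e G"
  shows "spanning_set (prod_spaces X Y) (prod_maps T R) (Z \<times> W) n e (F \<times> G)"
  unfolding spanning_set_def
proof (intro conjI ballI)
  show "F \<times> G \<subseteq> mspace (prod_spaces X Y 0)"
    using assms(2,3) by (auto simp: spanning_set_def prod_spaces_def)
  fix p assume "p \<in> Z \<times> W"
  then have p: "fst p \<in> Z" "snd p \<in> W" by auto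
  obtain x where x: "x \<in> F" "bowen_dist X T n (fst p) x \<le> e"
    using assms(2) p(1) unfolding spanning_set_def by blast
  obtain y where y: "y \<in> G" "bowen_dist Y R n (snd p) y \<le> e"
    using assms(3) p(2) unfolding spanning_set_def by blast
  show "\<exists>q\<in>F \<times> G. bowen_dist (prod_spaces X Y) (prod_maps T R) n p q \<le> e"
    by (rule bexI[of _ "(x, y)"]) (use x y in \<open>simp_all add: bowen_dist_prod_le_iff[OF assms(1)]\<close>)
qed

lemma separated_set_prod:
  assumes "n > 0" "separated_set X T Z n e E" "separated_set Y R W n e D"
  shows "separated_set (prod_spaces X Y) (prod_maps T R) (Z \<times> W) n e (E \<times> D)"
  unfolding separated_set_def
proof (intro conjI ballI impI)
  show "E \<times> D \<subseteq> Z \<times> W"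
    using assms(2,3) by (auto simp: separated_set_def)
  fix p q assume pq: "p \<in> E \<times> D" "q \<in> E \<times> D" "p \<noteq> q"
  then have "fst p \<noteq> fst q \<or> snd p \<noteq> snd q"
    by (simp add: prod_eq_iff)
  then have "e < bowen_dist X T n (fst p) (fst q) \<or> e < bowen_dist Y R n (snd p) (snd q)"
    using assms(2,3) pq(1,2) by (auto simp: separated_set_def)
  then show "e < bowen_dist (prod_spaces X Y) (prod_maps T R) n p q"
    using bowen_dist_prod_le_iff[OF assms(1), of X Y T R p q e] by linarith
qed

lemma growth_rate_Q_sum_prod_le:
  assumes "n > 0"
  shows "growth_rate (\<lambda>n. Q_sum (prod_spaces X Y) (prod_maps T R) (dot_plus f g) (Z \<times> W) n e) n
    \<le> growth_rate (\<lambda>n. Q_sum X T f Z n e) n + growth_rate (\<lambda>n. Q_sum Y R g W n e) n"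
    (is "?l \<le> ?r")
proof -
  let ?q = "Q_sum (prod_spaces X Y) (prod_maps T R) (dot_plus f g) (Z \<times> W) n e"
  let ?a = "Q_sum X T f Z n e" and ?b = "Q_sum Y R g W n e"
  have "ln_ennreal ?q \<le> ln_ennreal ?a + ln_ennreal ?b"
  proof (cases "?a = top \<or> ?b = top")
    case True
    \<comment> \<open>An infinite factor makes the right side \<open>\<infinity>\<close>, by the
      convention \<open>\<infinity> + -\<infinity> = \<infinity>\<close>.\<close>
    then show ?thesis by (auto simp: ln_ennreal_def)
  next
    case False
    have "?q \<le> exp_sum T f n F * exp_sum R g n G"
      if "spanning_set X T Z n e F" "spanning_set Y R W n e G" for F G
    proof -
      have "?q \<le> exp_sum (prod_maps T R) (dot_plus f g) n (F \<times> G)"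
        unfolding Q_sum_def by (rule INF_lower) (simp add: spanning_set_prod assms that)
      then show ?thesis by (simp add: exp_sum_prod)
    qed
    then have "?q \<le> ?a * ?b"
      using False unfolding Q_sum_def[of X] Q_sum_def[of Y]
      by (intro le_INF_mult_INF_ennreal) (simp_all only: less_top mem_Collect_eq simp_thms de_Morgan_disj)
    then show ?thesis
      using ln_ennreal_mono ln_ennreal_mult_le order_trans by blast
  qed
  then have "ereal (1 / real n) * ln_ennreal ?q
      \<le> ereal (1 / real n) * (ln_ennreal ?a + ln_ennreal ?b)"
    by (intro ereal_mult_left_mono) auto
  then show ?thesis
    using assms by (simp add: growth_rate_def ereal_pos_mult_add)
qed

text \<open>The sets \<open>E \<times> D\<close> are among the separated sets of the product system,
  and a product of suprema is the supremum over all pairs.\<close>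

lemma P_sum_prod_ge:
  assumes "n > 0"
  shows "P_sum X T f Z n e * P_sum Y R g W n e
    \<le> P_sum (prod_spaces X Y) (prod_maps T R) (dot_plus f g) (Z \<times> W) n e"
  unfolding P_sum_def[of X] P_sum_def[of Y] SUP_mult_left_ennreal SUP_mult_right_ennreal
proof (intro SUP_least)
  fix E D assume "E \<in> {E. separated_set X T Z n e E}" "D \<in> {D. separated_set Y R W n e D}"
  then have "separated_set (prod_spaces X Y) (prod_maps T R) (Z \<times> W) n e (E \<times> D)"
    using assms by (intro separated_set_prod) auto
  then show "exp_sum T f n E * exp_sum R g n D
      \<le> P_sum (prod_spaces X Y) (prod_maps T R) (dot_plus f g) (Z \<times> W) n e"
    unfolding P_sum_def exp_sum_prod[symmetric] by (intro SUP_upper) simp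
qed

text \<open>The two exclusions mean that neither \<open>P_sum\<close> vanishes, so the logarithm
  turns the product into a sum.\<close>

lemma growth_rate_P_sum_prod_ge:
  assumes "n > 0" "growth_rate (\<lambda>n. P_sum X T f Z n e) n \<noteq> -\<infinity>"
    "growth_rate (\<lambda>n. P_sum Y R g W n e) n \<noteq> -\<infinity>"
  shows "growth_rate (\<lambda>n. P_sum X T f Z n e) n + growth_rate (\<lambda>n. P_sum Y R g W n e) n
    \<le> growth_rate (\<lambda>n. P_sum (prod_spaces X Y) (prod_maps T R) (dot_plus f g) (Z \<times> W) n e) n"
proof -
  have "P_sum X T f Z n e \<noteq> 0" "P_sum Y R g W n e \<noteq> 0"
    using assms by (auto simp: growth_rate_def ln_ennreal_def)
  then have "growth_rate (\<lambda>n. P_sum X T f Z n e) n + growth_rate (\<lambda>n. P_sum Y R g W n e) n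
      = growth_rate (\<lambda>n. P_sum X T f Z n e * P_sum Y R g W n e) n"
    using assms(1) by (simp add: growth_rate_def ln_ennreal_mult ereal_pos_mult_add)
  also have "\<dots> \<le> growth_rate
      (\<lambda>n. P_sum (prod_spaces X Y) (prod_maps T R) (dot_plus f g) (Z \<times> W) n e) n"
    by (intro growth_rate_mono P_sum_prod_ge assms(1))
  finally show ?thesis .
qed

section \<open>Limits as the scale tends to 0\<close>

text \<open>\<open>Lim\<close> is meaningful only when a limit exists. Here it does, being the
  supremum over all positive scales.\<close>

lemma antimono_tendsto_Lim_at_right:
  fixes u :: "real \<Rightarrow> ereal"
  assumes "antimono_on {0<..} u"
  shows "(u \<longlongrightarrow> Lim (at_right 0) u) (at_right 0)"
proof -
  have "(u \<longlongrightarrow> (SUP e\<in>{0<..}. u e)) (at_right 0)"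
  proof (rule increasing_tendsto)
    show "\<forall>\<^sub>F e in at_right 0. u e \<le> (SUP e\<in>{0<..}. u e)"
      using eventually_at_right_less[of "0::real"] by eventually_elim (rule SUP_upper, simp)
    fix x assume "x < (SUP e\<in>{0<..}. u e)"
    \<comment> \<open>A scale \<open>d\<close> at which \<open>u\<close> already exceeds
      \<open>x\<close> serves for all smaller scales.\<close>
    then obtain d where d: "d > 0" "x < u d" by (auto simp: less_SUP_iff)
    then have "x < u e" if "0 < e" "e < d" for e
      using monotone_onD[OF assms, of e d] that by auto
    then show "\<forall>\<^sub>F e in at_right 0. x < u e"
      unfolding eventually_at_right_field using d(1) by blast
  qed
  then show ?thesis
    by (simp add: tendsto_Lim)
qed

lemma antimono_le_Lim_at_right:
  fixes u :: "real \<Rightarrow> ereal"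
  assumes "antimono_on {0<..} u" "e > 0"
  shows "u e \<le> Lim (at_right 0) u"
proof (rule tendsto_lowerbound[OF antimono_tendsto_Lim_at_right[OF assms(1)]])
  have "u e \<le> u d" if "0 < d" "d < e" for d
    using monotone_onD[OF assms(1), of d e] that by auto
  then show "\<forall>\<^sub>F d in at_right 0. u e \<le> u d"
    unfolding eventually_at_right_field using assms(2) by blast
qed simp

text \<open>The halved scale in \<open>ge\<close> disappears because every \<open>u (e / 2)\<close>
  lies below the limit of \<open>u\<close>; the remaining error \<open>c\<close> is
  arbitrary.\<close>

lemma Lim_at_right_eqI:
  fixes u v :: "real \<Rightarrow> ereal"
  assumes u: "antimono_on {0<..} u" and v: "antimono_on {0<..} v"
    and le: "\<And>e. 0 < e \<Longrightarrow> u e \<le> v e"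
    and ge: "\<And>c. 0 < c \<Longrightarrow> \<exists>d>0. \<forall>e. 0 < e \<and> e \<le> d \<longrightarrow> v e \<le> ereal c + u (e / 2)"
  shows "Lim (at_right 0) u = Lim (at_right 0) v"
proof (rule antisym)
  show "Lim (at_right 0) u \<le> Lim (at_right 0) v"
  proof (rule tendsto_le[OF _ antimono_tendsto_Lim_at_right[OF v] antimono_tendsto_Lim_at_right[OF u]])
    show "\<forall>\<^sub>F e in at_right 0. u e \<le> v e"
      using eventually_at_right_less[of "0::real"] by eventually_elim (rule le)
  qed simp
  show "Lim (at_right 0) v \<le> Lim (at_right 0) u"
  proof (rule ereal_le_epsilon2)
    fix c :: real assume "0 < c"
    then obtain d where d: "d > 0" "\<And>e. 0 < e \<Longrightarrow> e \<le> d \<Longrightarrow> v e \<le> ereal c + u (e / 2)"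
      using ge[OF \<open>0 < c\<close>] by auto
    have "v e \<le> Lim (at_right 0) u + ereal c" if e: "e > 0" "e < d" for e
    proof -
      have "v e \<le> ereal c + u (e / 2)" using d(2)[of e] e by simp
      also have "\<dots> \<le> ereal c + Lim (at_right 0) u"
        using e by (intro add_left_mono antimono_le_Lim_at_right[OF u]) auto
      finally show ?thesis by (simp add: add.commute)
    qed
    then have "\<forall>\<^sub>F e in at_right 0. v e \<le> Lim (at_right 0) u + ereal c"
      unfolding eventually_at_right_field using d(1) by (intro exI[of _ d]) simp
    then show "Lim (at_right 0) v \<le> Lim (at_right 0) u + ereal c"
      by (rule tendsto_upperbound[OF antimono_tendsto_Lim_at_right[OF v]]) simp
  qed
qed

lemma liminf_limsup_Q_antimono:
  "antimono_on A (\<lambda>e. liminf (growth_rate (\<lambda>n. Q_sum X T f Z n e)))"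
  "antimono_on A (\<lambda>e. limsup (growth_rate (\<lambda>n. Q_sum X T f Z n e)))"
  by (rule monotone_onI, rule Liminf_mono Limsup_mono, rule always_eventually, rule allI,
      rule growth_rate_mono, rule Q_sum_antimono, assumption)+

lemma liminf_limsup_P_antimono:
  "antimono_on A (\<lambda>e. liminf (growth_rate (\<lambda>n. P_sum X T f Z n e)))"
  "antimono_on A (\<lambda>e. limsup (growth_rate (\<lambda>n. P_sum X T f Z n e)))"
  by (rule monotone_onI, rule Liminf_mono Limsup_mono, rule always_eventually, rule allI,
      rule growth_rate_mono, rule P_sum_antimono, assumption)+

section \<open>Agreement of spanning and separated pressures\<close>

text \<open>At each scale the comparisons of \<open>Q_sum\<close> and \<open>P_sum\<close> become
  comparisons of growth rates, where the factor \<open>exp (n * c)\<close> turns into the additive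
  error \<open>c\<close>.\<close>

lemma Q_eq_P:
  assumes "carrier_maps X T" "Z \<subseteq> mspace (X 0)" "equicont_seq X f"
  shows "lower_Q X T f Z = lower_P X T f Z" "upper_Q X T f Z = upper_P X T f Z"
proof -
  let ?q = "\<lambda>e. growth_rate (\<lambda>n. Q_sum X T f Z n e)"
  let ?p = "\<lambda>e. growth_rate (\<lambda>n. P_sum X T f Z n e)"
  have le: "\<forall>\<^sub>F n in sequentially. ?q e n \<le> ?p e n" if "e > 0" for e
    using that by (intro eventually_growth_rate_mono Q_sum_le_P_sum assms) auto
  have "\<exists>d>0. \<forall>e. 0 < e \<and> e \<le> d \<longrightarrow> (\<forall>\<^sub>F n in sequentially. ?p e n \<le> ereal c + ?q (e / 2) n)"
    if "c > 0" for c
  proof -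
    obtain d where d: "d > 0" "\<And>k x y. x \<in> mspace (X k) \<Longrightarrow> y \<in> mspace (X k) \<Longrightarrow>
        mdist (X k) x y < d \<Longrightarrow> \<bar>f k x - f k y\<bar> < c"
      by (rule equicont_seqE[OF assms(3) \<open>c > 0\<close>]) (rule that)
    have "\<forall>\<^sub>F n in sequentially. ?p e n \<le> ereal c + ?q (e / 2) n" if e: "0 < e" "e \<le> d" for e
    proof -
      have "\<forall>\<^sub>F n in sequentially.
          ?p e n \<le> growth_rate (\<lambda>n. ennreal (exp (real n * c)) * Q_sum X T f Z n (e / 2)) n"
        using e \<open>c > 0\<close> d(2)
        by (intro eventually_growth_rate_mono P_sum_le_Q_sum[OF assms(1,2)]) auto
      then show ?thesis
        using eventually_gt_at_top[of 0] by eventually_elim (simp add: growth_rate_exp_mult)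
    qed
    then show ?thesis using d(1) by blast
  qed
  note ge = this
  show "lower_Q X T f Z = lower_P X T f Z"
    unfolding lower_Q_def lower_P_def
  proof (rule Lim_at_right_eqI)
    fix c :: real assume "c > 0"
    \<comment> \<open>The constant \<open>c\<close> moves inside the lower limit, where
      \<open>ge\<close> holds for large \<open>n\<close>.\<close>
    with ge[OF this] show "\<exists>d>0. \<forall>e. 0 < e \<and> e \<le> d \<longrightarrow> liminf (?p e) \<le> ereal c + liminf (?q (e / 2))"
      by (auto simp flip: Liminf_add_ereal_left intro!: Liminf_mono)
  qed (auto intro!: liminf_limsup_Q_antimono liminf_limsup_P_antimono Liminf_mono le)
  show "upper_Q X T f Z = upper_P X T f Z"
    unfolding upper_Q_def upper_P_def
  proof (rule Lim_at_right_eqI)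
    fix c :: real assume "c > 0"
    with ge[OF this] show "\<exists>d>0. \<forall>e. 0 < e \<and> e \<le> d \<longrightarrow> limsup (?p e) \<le> ereal c + limsup (?q (e / 2))"
      by (auto simp flip: Limsup_add_ereal_left intro!: Limsup_mono)
  qed (auto intro!: liminf_limsup_Q_antimono liminf_limsup_P_antimono Limsup_mono le)
qed

text \<open>Agreement of the two pressures gives the definite descriptions their unique witness. The
  lower pressure is then available in both forms: separated for the lower bound, spanning for the
  upper one.\<close>

lemma pressure_eq:
  assumes "carrier_maps X T" "Z \<subseteq> mspace (X 0)" "equicont_seq X f"
  shows "pressure_L X T f Z = lower_Q X T f Z" "pressure_L X T f Z = lower_P X T f Z"
    "pressure_U X T f Z = upper_Q X T f Z"
  unfolding pressure_L_def pressure_U_def using Q_eq_P[OF assms] by auto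

section \<open>The two product inequalities\<close>

lemma lower_Q_prod_le:
  "lower_Q (prod_spaces X Y) (prod_maps T R) (dot_plus f g) (Z \<times> W)
     \<le> lower_Q X T f Z + upper_Q Y R g W"
proof (cases "lower_Q X T f Z = \<infinity> \<or> upper_Q Y R g W = \<infinity>")
  case True
  \<comment> \<open>Addition in \<open>ereal\<close> makes the right side \<open>\<infinity>\<close>
    as soon as one summand is.\<close>
  then show ?thesis by auto
next
  case False
  let ?a = "\<lambda>e. growth_rate (\<lambda>n. Q_sum X T f Z n e)"
  let ?b = "\<lambda>e. growth_rate (\<lambda>n. Q_sum Y R g W n e)"
  let ?c = "\<lambda>e. growth_rate
      (\<lambda>n. Q_sum (prod_spaces X Y) (prod_maps T R) (dot_plus f g) (Z \<times> W) n e)"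
  have "liminf (?c e) \<le> liminf (?a e) + limsup (?b e)" for e
  proof -
    have "liminf (?c e) \<le> liminf (\<lambda>n. ?a e n + ?b e n)"
      using eventually_gt_at_top[of 0]
      by (intro Liminf_mono, eventually_elim) (rule growth_rate_Q_sum_prod_le)
    also have "\<dots> \<le> liminf (?a e) + limsup (?b e)"
      by (rule ereal_liminf_limsup_add)
    finally show ?thesis .
  qed
  moreover have "((\<lambda>e. liminf (?a e) + limsup (?b e)) \<longlongrightarrow> lower_Q X T f Z + upper_Q Y R g W)
      (at_right 0)"
    unfolding lower_Q_def upper_Q_def
    \<comment> \<open>Neither limit is \<open>\<infinity>\<close>, so the limit of the sum is the
      sum of the limits.\<close>
    using False
    by (intro tendsto_add_ereal_general antimono_tendsto_Lim_at_right liminf_limsup_Q_antimono)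
       (auto simp: lower_Q_def upper_Q_def)
  moreover have "((\<lambda>e. liminf (?c e)) \<longlongrightarrow>
      lower_Q (prod_spaces X Y) (prod_maps T R) (dot_plus f g) (Z \<times> W)) (at_right 0)"
    unfolding lower_Q_def by (intro antimono_tendsto_Lim_at_right liminf_limsup_Q_antimono)
  ultimately show ?thesis
    by (intro tendsto_le[of "at_right (0::real)"]) auto
qed

lemma lower_P_prod_ge:
  assumes "sum_defined (lower_P X T f Z) (lower_P Y R g W)"
  shows "lower_P X T f Z + lower_P Y R g W
     \<le> lower_P (prod_spaces X Y) (prod_maps T R) (dot_plus f g) (Z \<times> W)"
proof (cases "lower_P X T f Z = -\<infinity> \<or> lower_P Y R g W = -\<infinity>")
  case True
  \<comment> \<open>The hypothesis forbids the other summand to be \<open>\<infinity>\<close>, so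
    the left side is \<open>-\<infinity>\<close>.\<close>
  then show ?thesis
    using assms
    by (cases "lower_P X T f Z"; cases "lower_P Y R g W") (auto simp: sum_defined_def)
next
  case False
  let ?a = "\<lambda>e. growth_rate (\<lambda>n. P_sum X T f Z n e)"
  let ?b = "\<lambda>e. growth_rate (\<lambda>n. P_sum Y R g W n e)"
  let ?c = "\<lambda>e. growth_rate
      (\<lambda>n. P_sum (prod_spaces X Y) (prod_maps T R) (dot_plus f g) (Z \<times> W) n e)"
  have a: "((\<lambda>e. liminf (?a e)) \<longlongrightarrow> lower_P X T f Z) (at_right 0)"
    and b: "((\<lambda>e. liminf (?b e)) \<longlongrightarrow> lower_P Y R g W) (at_right 0)"
    and c: "((\<lambda>e. liminf (?c e)) \<longlongrightarrow>
      lower_P (prod_spaces X Y) (prod_maps T R) (dot_plus f g) (Z \<times> W)) (at_right 0)"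
    unfolding lower_P_def
    by (rule antimono_tendsto_Lim_at_right, rule liminf_limsup_P_antimono)+
  \<comment> \<open>Limits above \<open>-\<infinity>\<close> force the lower limits at small scales
    above it, and hence the growth rates for large \<open>n\<close>, where the logarithm of the
    product splits.\<close>
  have "\<forall>\<^sub>F e in at_right 0. -\<infinity> < liminf (?a e)" "\<forall>\<^sub>F e in at_right 0. -\<infinity> < liminf (?b e)"
    by (rule order_tendstoD(1)[OF a], use False in simp)
       (rule order_tendstoD(1)[OF b], use False in simp)
  then have "\<forall>\<^sub>F e in at_right 0. liminf (?a e) + liminf (?b e) \<le> liminf (?c e)"
  proof eventually_elim
    case (elim e)
    have "liminf (?a e) + liminf (?b e) \<le> liminf (\<lambda>n. ?a e n + ?b e n)"
      using elim by (intro ereal_liminf_add_mono) auto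
    also have "\<dots> \<le> liminf (?c e)"
    proof (rule Liminf_mono)
      show "\<forall>\<^sub>F n in sequentially. ?a e n + ?b e n \<le> ?c e n"
        using less_LiminfD[OF elim(1)] less_LiminfD[OF elim(2)] eventually_gt_at_top[of 0]
        by eventually_elim (intro growth_rate_P_sum_prod_ge; simp)
    qed
    finally show ?case .
  qed
  moreover have "((\<lambda>e. liminf (?a e) + liminf (?b e)) \<longlongrightarrow> lower_P X T f Z + lower_P Y R g W)
      (at_right 0)"
    using False by (intro tendsto_add_ereal_general a b) auto
  ultimately show ?thesis
    using c by (intro tendsto_le[of "at_right (0::real)"]) auto
qed

theorem theorem6p3:
  fixes X :: "nat \<Rightarrow> 'a metric" and T :: "nat \<Rightarrow> 'a \<Rightarrow> 'a"
    and Y :: "nat \<Rightarrow> 'b metric" and R :: "nat \<Rightarrow> 'b \<Rightarrow> 'b"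
    and Z :: "'a set" and W :: "'b set"
    and f :: "nat \<Rightarrow> 'a \<Rightarrow> real" and g :: "nat \<Rightarrow> 'b \<Rightarrow> real"
  assumes "nds X T" and "nds Y R"
    and "Z \<subseteq> mspace (X 0)" and "W \<subseteq> mspace (Y 0)"
    and "cont_seq X f" and "equicont_seq X f"
    and "cont_seq Y g" and "equicont_seq Y g"
    and "sum_defined (pressure_L X T f Z) (pressure_L Y R g W)"
    and "sum_defined (pressure_L X T f Z) (pressure_U Y R g W)"
  shows "pressure_L X T f Z + pressure_L Y R g W
           \<le> pressure_L (prod_spaces X Y) (prod_maps T R) (dot_plus f g) (Z \<times> W) \<and>
         pressure_L (prod_spaces X Y) (prod_maps T R) (dot_plus f g) (Z \<times> W)
           \<le> pressure_L X T f Z + pressure_U Y R g W"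
proof -
  note X = nds_carrier_maps[OF assms(1)] and Y = nds_carrier_maps[OF assms(2)]
  have ZW: "Z \<times> W \<subseteq> mspace (prod_spaces X Y 0)"
    using assms(3,4) by (auto simp: prod_spaces_def)
  \<comment> \<open>The product system has invariant carriers and an equicontinuous potential, so
    its pressures have both forms as well.\<close>
  note eqX = pressure_eq[OF X assms(3,6)] and eqY = pressure_eq[OF Y assms(4,8)]
    and eqXY = pressure_eq[OF carrier_maps_prod[OF X Y] ZW equicont_seq_dot_plus[OF assms(6,8)]]
  show ?thesis
  proof
    show "pressure_L X T f Z + pressure_L Y R g W
        \<le> pressure_L (prod_spaces X Y) (prod_maps T R) (dot_plus f g) (Z \<times> W)"
      using assms(9) unfolding eqX(2) eqY(2) eqXY(2) by (rule lower_P_prod_ge)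
    show "pressure_L (prod_spaces X Y) (prod_maps T R) (dot_plus f g) (Z \<times> W)
        \<le> pressure_L X T f Z + pressure_U Y R g W"
      unfolding eqX(1) eqY(3) eqXY(1) by (rule lower_Q_prod_le)
  qed
qed

end
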